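(* Let $X\subset\mathbb{C}$ be a continuum. Then $F_x^*=E_x^*$ for every $x\in X$; moreover, for $x\in X$, $F_x^*=\{x\}$ implies that $X$ is locally connected at $x$.
   Context: A continuum is a nonempty compact connected metric space (possibly a single point). $X^o$ and $\partial X$ denote the interior and boundary of $X$ in $\mathbb{C}$. A point $x\in\partial X$ is separated from a point $y\in\partial X$ by a subset $C\subset X$ if there is a separation $\partial X\setminus C=A\cup B$, i.e. a decomposition with $\overline{A}\cap B=A\cap\overline{B}=\emptyset$, such that $x\in A$ and $y\in B$. The modified pseudo-fiber $E_x^*$ of $X$ at $x$ is: $E_x^*=\{x\}$ if $x\in X^o$; and, if $x\in\partial X$, $E_x^*$ is the set of points $y\in\partial X$ that cannot be separated from $x$ by any finite set $C\subset\partial X$. The modified fiber $F_x^*$ of $X$ at $x$ is the connected component of $E_x^*$ containing $x$. $X$ is locally connected at $x$ if every neighborhood $U$ of $x$ in $X$ contains a connected (not necessarily open) neighborhood $V$ of $x$ in $X$. *)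

theory Defs
  imports "HOL-Analysis.Analysis"
begin

definition continuum :: "complex set \<Rightarrow> bool" where
  "continuum X \<longleftrightarrow> X \<noteq> {} \<and> compact X \<and> connected X"

(* Both points necessarily lie in frontier X and outside C, since A \<union> B = frontier X - C. *)
definition separated_by :: "complex set \<Rightarrow> complex set \<Rightarrow> complex \<Rightarrow> complex \<Rightarrow> bool" where
  "separated_by X C x y \<longleftrightarrow>
     C \<subseteq> X \<and>
     (\<exists>A B. frontier X - C = A \<union> B \<and> closure A \<inter> B = {} \<and> A \<inter> closure B = {} \<and>
            x \<in> A \<and> y \<in> B)"

(* The value is only meaningful for x \<in> X. *)
definition modified_pseudo_fiber :: "complex set \<Rightarrow> complex \<Rightarrow> complex set" where
  "modified_pseudo_fiber X x =
     (if x \<in> interior X then {x}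
      else {y \<in> frontier X. \<not> (\<exists>C. finite C \<and> C \<subseteq> frontier X \<and> separated_by X C x y)})"

definition modified_fiber :: "complex set \<Rightarrow> complex \<Rightarrow> complex set" where
  "modified_fiber X x = connected_component_set (modified_pseudo_fiber X x) x"

end

theory Submission
  imports Defs
begin

text \<open>
  Write \<open>K\<close> for the frontier of \<open>X\<close>.  A finite set separates \<open>x\<close> from \<open>y\<close> in \<open>K\<close> exactly when
  \<open>y\<close> has a neighbourhood \<open>W\<close>, open in \<open>K\<close>, with finite boundary and with \<open>x\<close> outside its
  closure.  Such sets are stable under finite unions, so by compactness a single one of them covers
  any compact subset of \<open>K\<close> that misses the pseudo-fiber of \<open>x\<close>
  (\<open>compact_subset_finitely_bounded_in\<close>).  Both halves of the theorem apply this to a suitable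
  compact set.

  \<^bold>\<open>Fibers are pseudo-fibers.\<close>  Suppose that the pseudo-fiber splits into closed sets \<open>M\<close>, which
  contains \<open>x\<close>, and \<open>N\<close>.  Take an open \<open>U\<close> around \<open>N\<close> whose closure misses \<open>M\<close>, and cover the
  boundary of \<open>U\<close> in \<open>K\<close> by such a \<open>W\<close>.  Then \<open>(K \<inter> U) \<union> W\<close> has finite boundary, so
  it cuts \<open>N\<close> off from \<open>x\<close>, and \<open>N\<close> is empty.  This is a property of all compact metric
  spaces \<open>K\<close> (\<open>connected_not_finitely_separated\<close>).

  \<^bold>\<open>A trivial fiber gives local connectedness.\<close>  Covering the part of \<open>K\<close> outside a small disc
  shows that \<open>x\<close> has arbitrarily small neighbourhoods \<open>G\<close> in \<open>K\<close> with finite boundary.  Choose \<open>G\<close>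
  inside a disc \<open>D\<close> around \<open>x\<close>; if \<open>X\<close> lies in the interior of \<open>D\<close>, then \<open>X\<close> itself is a small
  connected neighbourhood.  Otherwise the topology of the plane enters: if two components of
  \<open>X \<inter> D\<close> both come close to \<open>x\<close>, then each of them meets the boundary of \<open>G\<close>
  (\<open>crossing_component_meets_boundary\<close>).  Indeed both reach the boundary circle of \<open>D\<close>; viewed
  from one component \<open>Q\<close>, the other one lies in a component \<open>O'\<close> of the complement of \<open>Q\<close>, and the
  frontier of \<open>O'\<close> is a connected subset of \<open>Q\<close> which crosses all circles that both components
  cross.  In the interior of \<open>D\<close> it consists of points of \<open>K\<close>; so near \<open>x\<close> it meets \<open>G\<close>, on the
  boundary circle it is outside \<open>G\<close>, and in between it meets the boundary of \<open>G\<close>.  That boundary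
  being finite, only finitely many components of \<open>X \<inter> D\<close> come close to \<open>x\<close>.  They are closed, so
  the one containing \<open>x\<close> is a neighbourhood of \<open>x\<close>.
\<close>

section \<open>Relatively open sets with finite boundary\<close>

text \<open>
  When \<open>K\<close> is closed, \<open>closure W - W\<close> is the boundary of \<open>W\<close> in the space \<open>K\<close>.
\<close>

definition finitely_bounded_in :: "'a::topological_space set \<Rightarrow> 'a set \<Rightarrow> bool" where
  "finitely_bounded_in K W \<longleftrightarrow> openin (top_of_set K) W \<and> finite (closure W - W)"

lemma closure_Diff_closure_subset:
  assumes "closed K" "openin (top_of_set K) W"
  shows "closure (K - closure W) \<subseteq> K - W"
proof (rule closure_minimal)
  have "closedin (top_of_set K) (K - W)"
    by (rule closedin_diff[OF _ assms(2)]) simp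
  then show "closed (K - W)"
    using assms(1) by (rule closedin_closed_trans)
qed (use closure_subset[of W] in blast)

text \<open>
  A separating set \<open>C\<close> contains the boundary of the side of \<open>y\<close>; conversely, the boundary of \<open>W\<close>
  separates \<open>W\<close> from the complement of its closure.
\<close>

lemma separated_by_finite_iff:
  assumes "closed X" and x: "x \<in> frontier X"
  shows "(\<exists>C. finite C \<and> C \<subseteq> frontier X \<and> separated_by X C x y) \<longleftrightarrow>
         (\<exists>W. finitely_bounded_in (frontier X) W \<and> y \<in> W \<and> x \<notin> closure W)"
proof
  assume "\<exists>C. finite C \<and> C \<subseteq> frontier X \<and> separated_by X C x y"
  then obtain C A B where C: "finite C" "C \<subseteq> frontier X" 
    and AB: "frontier X - C = A \<union> B" "closure A \<inter> B = {}" "A \<inter> closure B = {}" 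
            "x \<in> A" "y \<in> B"
    unfolding separated_by_def by blast
  \<comment> \<open>Removing a finite set leaves an open set, so \<open>B\<close> is open in the frontier itself.\<close>
  have "B = frontier X \<inter> (- closure A \<inter> - C)"
    using AB(1,2) closure_subset[of A] by blast
  moreover have "open (- closure A \<inter> - C)"
    using finite_imp_closed[OF \<open>finite C\<close>] by (simp add: open_Int open_Compl)
  ultimately have "openin (top_of_set (frontier X)) B"
    by (metis openin_open_Int)
  moreover have "closure B \<subseteq> frontier X"
    using AB(1) by (intro closure_minimal) auto
  then have "closure B - B \<subseteq> C"
    using AB(1,3) by blast
  then have "finite (closure B - B)"
    using C(1) finite_subset by blast
  ultimately show "\<exists>W. finitely_bounded_in (frontier X) W \<and> y \<in> W \<and> x \<notin> closure W"
    using AB unfolding finitely_bounded_in_def by blast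
next
  assume "\<exists>W. finitely_bounded_in (frontier X) W \<and> y \<in> W \<and> x \<notin> closure W"
  then obtain W where W: "openin (top_of_set (frontier X)) W" "finite (closure W - W)" 
      "y \<in> W" "x \<notin> closure W"
    unfolding finitely_bounded_in_def by blast
  have W_sub: "W \<subseteq> frontier X"
    using W(1) openin_imp_subset by blast
  then have cl_sub: "closure W \<subseteq> frontier X"
    by (intro closure_minimal) auto
  have "closure (frontier X - closure W) \<subseteq> frontier X - W"
    using closure_Diff_closure_subset[OF frontier_closed W(1)] .
  moreover have "frontier X - (closure W - W) = (frontier X - closure W) \<union> W"
    using W_sub closure_subset[of W] by blast
  moreover have "frontier X \<subseteq> X"
    using \<open>closed X\<close> frontier_subset_closed by blast
  ultimately have "separated_by X (closure W - W) x y"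
    unfolding separated_by_def using W(3,4) x cl_sub
    by (intro conjI exI[of _ "frontier X - closure W"] exI[of _ W]) auto
  then show "\<exists>C. finite C \<and> C \<subseteq> frontier X \<and> separated_by X C x y"
    using W(2) cl_sub by blast
qed

lemma finitely_bounded_in_Un:
  assumes "finitely_bounded_in K V" "finitely_bounded_in K W"
  shows "finitely_bounded_in K (V \<union> W)"
proof -
  have "closure (V \<union> W) - (V \<union> W) \<subseteq> (closure V - V) \<union> (closure W - W)"
    by auto
  then show ?thesis
    using assms unfolding finitely_bounded_in_def
    by (meson finite_UnI finite_subset openin_Un)
qed

lemma compact_subset_finitely_bounded_in:
  fixes x :: "'a::topological_space"
  assumes "compact T"
    and cover: "\<And>z. z \<in> T \<Longrightarrow> \<exists>W. finitely_bounded_in K W \<and> z \<in> W \<and> x \<notin> closure W"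
  obtains W where "finitely_bounded_in K W" "T \<subseteq> W" "x \<notin> closure W"
proof -
  let ?\<W> = "{W. finitely_bounded_in K W \<and> x \<notin> closure W}"
  have Union: "finitely_bounded_in K (\<Union>\<F>) \<and> x \<notin> closure (\<Union>\<F>)" 
    if "finite \<F>" "\<F> \<subseteq> ?\<W>" for \<F>
    using that
  proof (induction \<F>)
    case empty
    then show ?case by (simp add: finitely_bounded_in_def)
  next
    case (insert W \<F>)
    then show ?case by (simp add: finitely_bounded_in_Un)
  qed
  have "\<exists>O'. open O' \<and> W = K \<inter> O'" if "W \<in> ?\<W>" for W
    using that by (auto simp: finitely_bounded_in_def openin_open)
  then obtain f where f: "\<And>W. W \<in> ?\<W> \<Longrightarrow> open (f W) \<and> W = K \<inter> f W"
    by metis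
  have "T \<subseteq> (\<Union>W\<in>?\<W>. f W)" and "T \<subseteq> K"
    using cover f by blast+
  then obtain \<F> where "\<F> \<subseteq> ?\<W>" "finite \<F>" "T \<subseteq> (\<Union>W\<in>\<F>. f W)"
    using \<open>compact T\<close> f by (meson compactE_image)
  moreover from this have "T \<subseteq> \<Union>\<F>"
    using f \<open>T \<subseteq> K\<close> by blast
  ultimately show thesis
    using Union that by blast
qed

section \<open>Connectedness of the pseudo-fiber\<close>

text \<open>
  The delicate case of a splitting is that of a finite \<open>N\<close> whose points are needed by the finite sets
  that separate nearby points from \<open>x\<close>.  Adding \<open>K \<inter> U\<close> to \<open>W\<close> removes them from the boundary,
  since \<open>N \<subseteq> U\<close>.
\<close>

lemma connected_not_finitely_separated:
  fixes K :: "'a::metric_space set"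
  assumes "compact K" "x \<in> K"
  shows "connected {y \<in> K. \<not> (\<exists>W. finitely_bounded_in K W \<and> y \<in> W \<and> x \<notin> closure W)}"
    (is "connected ?E")
proof -
  have "?E = K - (\<Union>{W. finitely_bounded_in K W \<and> x \<notin> closure W})"
    by auto
  moreover have "openin (top_of_set K) (\<Union>{W. finitely_bounded_in K W \<and> x \<notin> closure W})"
    by (intro openin_Union) (auto simp: finitely_bounded_in_def)
  ultimately have "closedin (top_of_set K) ?E"
    by (simp add: closedin_diff)
  then have closed_E: "closed ?E"
    using \<open>compact K\<close> closedin_closed_eq compact_imp_closed by blast
  have x_E: "x \<in> ?E"
    using \<open>x \<in> K\<close> closure_subset by blast
  have no_split: False 
    if MN: "closed M" "closed N" "M \<union> N = ?E" "M \<inter> N = {}" and "x \<in> M" "y \<in> N" for M N y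
  proof -
    obtain U V where UV: "open U" "open V" "N \<subseteq> U" "M \<subseteq> V" "U \<inter> V = {}"
      using t4_space[of N M] MN by (metis Int_commute)
    then have cl_U: "closure U \<inter> M = {}"
      using open_Int_closure_eq_empty[of V U] by blast
    let ?T = "K \<inter> frontier U"
    have "compact ?T"
      using \<open>compact K\<close> by (simp add: compact_Int_closed)
    moreover have "?T \<inter> ?E = {}"
      using cl_U UV(1,3) MN(3) by (auto simp: frontier_def interior_open)
    ultimately obtain W where W: "finitely_bounded_in K W" "?T \<subseteq> W" "x \<notin> closure W"
      using compact_subset_finitely_bounded_in[of ?T K x] by blast
    let ?W = "K \<inter> U \<union> W"
    have cl_KU: "closure (K \<inter> U) \<subseteq> K \<inter> closure U"
      using \<open>compact K\<close> closure_subset[of U]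
      by (intro closure_minimal) (auto intro: compact_imp_closed)
    \<comment> \<open>The boundary of \<open>U\<close> inside \<open>K\<close> is swallowed by \<open>W\<close>, so only boundary points of
       \<open>W\<close> survive.\<close>
    have "closure ?W - ?W \<subseteq> closure W - W"
      using cl_KU W(2) UV(1) by (auto simp: frontier_def interior_open)
    then have "finitely_bounded_in K ?W"
      using W(1) UV(1) unfolding finitely_bounded_in_def
      by (meson finite_subset openin_Un openin_open_Int)
    moreover have "y \<in> ?W"
      using \<open>y \<in> N\<close> UV(3) MN(3) by blast
    moreover have "x \<notin> closure ?W"
      using cl_KU cl_U W(3) \<open>x \<in> M\<close> by auto
    ultimately show False
      using \<open>y \<in> N\<close> MN(3) by blast
  qed
  show ?thesis
    unfolding connected_closed_set[OF closed_E]
  proof clarify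
    fix A B
    assume "closed A" "closed B" "A \<noteq> {}" "B \<noteq> {}" "A \<union> B = ?E" "A \<inter> B = {}"
    then show False
      using no_split[of A B] no_split[of B A] x_E by (metis Int_commute Un_commute UnE ex_in_conv)
  qed
qed

section \<open>Small finitely bounded neighbourhoods and local connectedness\<close>

text \<open>
  Boundary bumping: a component inside the open ball would have a clopen neighbourhood \<open>T\<close> in
  \<open>X \<inter> cball x r\<close> that stays in the open ball, and \<open>T\<close> would then be clopen in \<open>X\<close>.
\<close>

lemma component_in_cball_meets_sphere:
  fixes X :: "'a::euclidean_space set"
  assumes X: "closed X" "connected X" "\<not> X \<subseteq> ball x r"
    and Q: "Q \<in> components (X \<inter> cball x r)"
  shows "Q \<inter> sphere x r \<noteq> {}"
proof
  assume "Q \<inter> sphere x r = {}"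
  then have Q_ball: "Q \<subseteq> ball x r"
    using in_components_subset[OF Q] by force
  have "compact (X \<inter> cball x r)"
    using X(1) by (simp add: closed_Int_compact)
  then obtain T where T: "openin (top_of_set (X \<inter> cball x r)) T" "compact T" "Q \<subseteq> T" 
      "T \<subseteq> ball x r"
    using Sura_Bura_clopen_subset[OF _ Q _ open_ball Q_ball]
    by (metis Q closed_Int_compact compact_components closed_imp_locally_compact compact_imp_closed)
  obtain V where "open V" "T = (X \<inter> cball x r) \<inter> V"
    using T(1) by (auto simp: openin_open)
  then have "T = X \<inter> (V \<inter> ball x r)"
    using T(4) by auto
  then have "openin (top_of_set X) T"
    using \<open>open V\<close> by (metis open_Int open_ball openin_open_Int)
  moreover have "closedin (top_of_set X) T"
    using T(2) \<open>T = X \<inter> (V \<inter> ball x r)\<close> by (metis Int_lower1 closed_subset compact_imp_closed)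
  moreover have "T \<noteq> {}"
    using T(3) in_components_nonempty[OF Q] by blast
  ultimately have "T = X"
    using X(2) connected_clopen by blast
  then show False
    using T(4) X(3) by blast
qed

text \<open>
  The component \<open>Q'\<close> witnesses that \<open>Q\<close> does not fill the spheres around \<open>x\<close>.  The points where
  \<open>Q\<close> faces \<open>Q'\<close> form the frontier of a component of the complement of \<open>Q\<close>, which is connected by
  the unicoherence of Euclidean space; those of them in the open ball are frontier points of \<open>X\<close>.
\<close>

lemma crossing_component_meets_boundary:
  fixes X :: "'a::euclidean_space set"
  assumes "2 \<le> DIM('a)" "closed X"
    and Q: "Q \<in> components (X \<inter> cball x r)" and Q': "Q' \<in> components (X \<inter> cball x r)" 
    and "Q \<noteq> Q'"
    and outer: "Q \<inter> sphere x r \<noteq> {}" "Q' \<inter> sphere x r \<noteq> {}"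
    and inner: "Q \<inter> ball x \<delta> \<noteq> {}" "Q' \<inter> ball x \<delta> \<noteq> {}" and "\<delta> \<le> r"
    and G: "openin (top_of_set (frontier X)) G" "G \<subseteq> ball x r" "frontier X \<inter> ball x \<delta> \<subseteq> G"
  shows "Q \<inter> (closure G - G) \<noteq> {}"
proof
  assume disj: "Q \<inter> (closure G - G) = {}"
  have Q_sub: "Q \<subseteq> X \<inter> cball x r" and Q'_sub: "Q' \<subseteq> X \<inter> cball x r"
    using Q Q' in_components_subset by blast+
  have conn: "connected Q" "connected Q'"
    using Q Q' in_components_connected by blast+
  have "closed Q"
    using Q \<open>closed X\<close> by (metis closed_Int closed_cball closed_components)
  have QQ': "Q \<inter> Q' = {}"
    using Q Q' \<open>Q \<noteq> Q'\<close> components_nonoverlap by blast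
  then obtain O' where O': "O' \<in> components (- Q)" "Q' \<subseteq> O'"
    using exists_component_superset[of Q' "- Q"] conn(2) inner(2) by blast
  let ?F = "frontier O'"
  have conn_F: "connected ?F"
    using connected_frontier_component_complement[OF conn(1) O'(1)] .
  have F_Q: "?F \<subseteq> Q"
    using frontier_of_components_closed_complement[OF \<open>closed Q\<close> O'(1)] .
  have O'_Q: "O' \<inter> Q = {}"
    using in_components_subset[OF O'(1)] by blast
  have F_sphere: "?F \<inter> sphere x s \<noteq> {}" if "Q \<inter> sphere x s \<noteq> {}" "Q' \<inter> sphere x s \<noteq> {}" for s
    using connected_Int_frontier[OF connected_sphere[OF \<open>2 \<le> DIM('a)\<close>], of x s O'] 
      that O'_Q O'(2) by blast
  have sphere_crossed: "P \<inter> sphere x s \<noteq> {}" 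
    if P: "connected P" "p \<in> P" "dist x p \<le> s" "s \<le> r" "P \<inter> sphere x r \<noteq> {}" for P p s
  proof -
    obtain q where q: "q \<in> P" "dist x q = r" 
      using P(5) unfolding sphere_def by blast
    have "connected (dist x ` P)"
      using P(1) by (intro connected_continuous_image continuous_intros)
    then have "s \<in> dist x ` P"
      using connectedD_interval[of "dist x ` P" "dist x p" "dist x q" s] q P(2-4) by blast
    then show ?thesis by auto
  qed
  obtain p p' where p: "p \<in> Q" "p' \<in> Q'" "dist x p < \<delta>" "dist x p' < \<delta>"
    using inner by auto
  \<comment> \<open>The sphere of radius \<open>s\<close> lies in the small ball and is crossed by both components.\<close>
  define s where "s = max (dist x p) (dist x p')"
  have s: "dist x p \<le> s" "dist x p' \<le> s" "s < \<delta>" "s \<le> r"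
    using p \<open>\<delta> \<le> r\<close> by (auto simp: s_def)
  have "?F \<inter> sphere x s \<noteq> {}"
    using F_sphere[OF sphere_crossed[OF conn(1) p(1) s(1,4) outer(1)]
      sphere_crossed[OF conn(2) p(2) s(2,4) outer(2)]] .
  then obtain a where a: "a \<in> ?F" "dist x a < \<delta>"
    using s(3) by auto
  obtain b where b: "b \<in> ?F" "dist x b = r"
    using F_sphere[OF outer] unfolding sphere_def by blast
  have F_frontier: "z \<in> frontier X" if z: "z \<in> ?F" "z \<in> ball x r" for z
  proof (rule ccontr)
    \<comment> \<open>A ball around \<open>z\<close> inside \<open>X \<inter> cball x r\<close> would belong to \<open>Q\<close> and so miss \<open>O'\<close>.\<close>
    assume "z \<notin> frontier X"
    moreover have "z \<in> X"
      using z(1) F_Q Q_sub by blast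
    ultimately have "z \<in> interior X \<inter> ball x r"
      using z(2) closure_subset[of X] by (auto simp: frontier_def)
    then obtain e where e: "e > 0" "ball z e \<subseteq> interior X \<inter> ball x r"
      by (meson open_Int open_ball open_contains_ball open_interior)
    then have "ball z e \<subseteq> X \<inter> cball x r"
      using interior_subset[of X] ball_subset_cball by blast
    moreover have "Q \<inter> ball z e \<noteq> {}"
      using z(1) F_Q e(1) by auto
    ultimately have "ball z e \<subseteq> Q"
      using components_maximal[OF Q] by blast
    then have "ball z e \<inter> O' = {}"
      using O'_Q by blast
    then have "ball z e \<inter> closure O' = {}"
      by (simp add: open_Int_closure_eq_empty)
    moreover have "z \<in> ball z e"
      using e(1) by simp
    ultimately show False
      using z(1) unfolding frontier_def by blast
  qed
  \<comment> \<open>Now \<open>G\<close> cuts out of the connected set \<open>?F\<close> a clopen part that contains \<open>a\<close> but not \<open>b\<close>.\<close>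
  obtain T where T: "open T" "G = frontier X \<inter> T"
    using G(1) by (auto simp: openin_open)
  have FG: "?F \<inter> G = ?F \<inter> (T \<inter> ball x r)"
    using F_frontier G(2) T(2) by blast
  have "openin (top_of_set ?F) (?F \<inter> G)"
    unfolding FG using T(1) by (simp add: open_Int openin_open_Int)
  moreover have "?F \<inter> G = ?F \<inter> closure G"
    using disj F_Q closure_subset[of G] by blast
  then have "closedin (top_of_set ?F) (?F \<inter> G)"
    by (simp add: closedin_closed_Int)
  ultimately have "?F \<inter> G = {} \<or> ?F \<inter> G = ?F"
    using conn_F connected_clopen by blast
  moreover have "a \<in> ?F \<inter> G"
    using a F_frontier \<open>\<delta> \<le> r\<close> G(3) by auto
  moreover have "b \<notin> G"
    using b(2) G(2) by auto
  ultimately show False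
    using b(1) by blast
qed

text \<open>
  The condition with \<open>\<delta>\<close> makes \<open>G\<close> a neighbourhood of \<open>x\<close> relative to the frontier; at an
  interior point of \<open>X\<close> it is satisfied by the empty set.
\<close>

lemma weakly_locally_connected_at_if_finitely_bounded:
  fixes X :: "'a::euclidean_space set"
  assumes "2 \<le> DIM('a)" and X: "closed X" "connected X" and "x \<in> X"
    and small: "\<And>r. r > 0 \<Longrightarrow> \<exists>G \<delta>. finitely_bounded_in (frontier X) G \<and> G \<subseteq> ball x r \<and> 
                   \<delta> > 0 \<and> frontier X \<inter> ball x \<delta> \<subseteq> G"
  shows "weakly_locally_connected_at x (top_of_set X)"
  unfolding weakly_locally_connected_at_def neighbourhood_base_at_def
proof clarify
  fix U
  assume "openin (top_of_set X) U" "x \<in> U"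
  then obtain r where r: "r > 0" "X \<inter> cball x r \<subseteq> U"
    by (metis Int_commute openin_contains_cball)
  show "\<exists>V Q. openin (top_of_set X) V \<and> connectedin (top_of_set X) Q \<and> x \<in> V \<and> V \<subseteq> Q \<and> Q \<subseteq> U"
  proof (cases "X \<subseteq> ball x r")
    case True
    then have "X \<subseteq> U"
      using r(2) ball_subset_cball by blast
    then show ?thesis
      using X(2) \<open>x \<in> X\<close> by (intro exI[of _ X]) auto
  next
    case False
    obtain G \<delta>' where G: "openin (top_of_set (frontier X)) G" "finite (closure G - G)" 
        "G \<subseteq> ball x r" and \<delta>': "\<delta>' > 0" "frontier X \<inter> ball x \<delta>' \<subseteq> G"
      using small[OF r(1)] unfolding finitely_bounded_in_def by blast
    define \<delta> where "\<delta> = min \<delta>' r"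
    have \<delta>: "\<delta> > 0" "\<delta> \<le> r" "frontier X \<inter> ball x \<delta> \<subseteq> G"
      using \<delta>' r(1) by (auto simp: \<delta>_def)
    let ?D = "X \<inter> cball x r"
    define Q where "Q = connected_component_set ?D x"
    have "x \<in> ?D"
      using \<open>x \<in> X\<close> r(1) by simp
    then have Q: "Q \<in> components ?D" and "x \<in> Q"
      by (auto simp: Q_def componentsI)
    \<comment> \<open>The components other than \<open>Q\<close> that come close to \<open>x\<close>; each contains one of the finitely
       many boundary points of \<open>G\<close>.\<close>
    define \<C> where "\<C> = {P \<in> components ?D. P \<noteq> Q \<and> P \<inter> ball x \<delta> \<noteq> {}}"
    have meets: "P \<inter> (closure G - G) \<noteq> {}" if P: "P \<in> \<C>" for P
    proof -
      have "Q \<inter> ball x \<delta> \<noteq> {}"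
        using \<open>x \<in> Q\<close> \<delta>(1) by auto
      moreover have "P \<in> components ?D" "P \<noteq> Q" "P \<inter> ball x \<delta> \<noteq> {}"
        using P by (auto simp: \<C>_def)
      ultimately show ?thesis
        using crossing_component_meets_boundary[OF assms(1) X(1) _ Q _ _ _ _ _ \<delta>(2) G(1,3) \<delta>(3)]
          component_in_cball_meets_sphere[OF X False] Q by metis
    qed
    have "P \<in> connected_component_set ?D ` (closure G - G)" if P: "P \<in> \<C>" for P
    proof -
      obtain c where c: "c \<in> P" "c \<in> closure G - G"
        using meets[OF P] by blast
      have "P \<in> components ?D"
        using P by (simp add: \<C>_def)
      then have "P = connected_component_set ?D c"
        using c(1) by (metis components_iff connected_component_eq)
      then show ?thesis
        using c(2) by blast
    qed
    then have "\<C> \<subseteq> connected_component_set ?D ` (closure G - G)"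
      by blast
    then have "finite \<C>"
      using G(2) finite_surj by blast
    moreover have "closed P" if "P \<in> \<C>" for P
      using that closed_components[of ?D P] X(1) by (simp add: \<C>_def closed_Int)
    ultimately have "closed (\<Union>\<C>)"
      by blast
    let ?V = "X \<inter> (ball x \<delta> - \<Union>\<C>)"
    have "openin (top_of_set X) ?V"
      using \<open>closed (\<Union>\<C>)\<close> by (simp add: open_Diff openin_open_Int)
    moreover have "x \<in> ?V"
      using \<open>x \<in> X\<close> \<delta>(1) \<open>x \<in> Q\<close> Q components_nonoverlap unfolding \<C>_def by fastforce
    moreover have "?V \<subseteq> Q"
    proof
      fix y
      assume y: "y \<in> ?V"
      then have "y \<in> ?D"
        using \<delta>(2) by auto
      then obtain P where "P \<in> components ?D" "y \<in> P"
        by (metis UnionE Union_components)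
      then show "y \<in> Q"
        using y unfolding \<C>_def by blast
    qed
    moreover have "Q \<subseteq> ?D" "connected Q"
      by (simp_all only: Q_def connected_component_subset connected_connected_component)
    then have "connectedin (top_of_set X) Q" "Q \<subseteq> U"
      using r(2) by (auto simp: connectedin_subtopology)
    ultimately show ?thesis
      by blast
  qed
qed

section \<open>Modified fibers\<close>

lemma modified_pseudo_fiber_frontier:
  assumes "closed X" "x \<in> frontier X"
  shows "modified_pseudo_fiber X x =
    {y \<in> frontier X. \<not> (\<exists>W. finitely_bounded_in (frontier X) W \<and> y \<in> W \<and> x \<notin> closure W)}"
proof -
  have "x \<notin> interior X"
    using assms(2) by (simp add: frontier_def)
  then show ?thesis
    by (simp only: modified_pseudo_fiber_def if_False separated_by_finite_iff[OF assms])
qed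

text \<open>
  One finitely bounded set covers everything outside the ball, and the complement of its closure is
  the required neighbourhood: its boundary points are boundary points of the covering set.
\<close>

lemma finitely_bounded_neighbourhood_if_trivial_pseudo_fiber:
  assumes "compact X" and x: "x \<in> frontier X" and trivial: "modified_pseudo_fiber X x = {x}" 
    and "r > 0"
  shows "\<exists>G \<delta>. finitely_bounded_in (frontier X) G \<and> G \<subseteq> ball x r \<and> 
               \<delta> > 0 \<and> frontier X \<inter> ball x \<delta> \<subseteq> G"
proof -
  let ?K = "frontier X"
  have "closed X" "compact ?K"
    using \<open>compact X\<close> by (auto simp: compact_imp_closed compact_frontier)
  have "compact (?K - ball x r)"
    using \<open>compact ?K\<close> by (simp add: compact_diff)
  moreover have "\<exists>W. finitely_bounded_in ?K W \<and> z \<in> W \<and> x \<notin> closure W" if "z \<in> ?K - ball x r" for z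
  proof -
    have "z \<noteq> x" and "z \<in> ?K"
      using that \<open>r > 0\<close> by auto
    then have "z \<notin> modified_pseudo_fiber X x"
      using trivial by blast
    then show ?thesis
      using \<open>z \<in> ?K\<close> unfolding modified_pseudo_fiber_frontier[OF \<open>closed X\<close> x] by blast
  qed
  ultimately obtain W where W: "finitely_bounded_in ?K W" "?K - ball x r \<subseteq> W" "x \<notin> closure W"
    using compact_subset_finitely_bounded_in by blast
  let ?G = "?K - closure W"
  have "open (- closure W)"
    by auto
  have "?G = ?K \<inter> - closure W"
    by blast
  then have "openin (top_of_set ?K) ?G"
    using \<open>open (- closure W)\<close> by (metis openin_open_Int)
  moreover have "closure ?G \<subseteq> ?K - W"
    using W(1) unfolding finitely_bounded_in_def
    by (intro closure_Diff_closure_subset) auto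
  then have "finite (closure ?G - ?G)"
    using W(1) unfolding finitely_bounded_in_def 
    by (elim conjE, elim rev_finite_subset) blast
  moreover have "?G \<subseteq> ball x r"
    using W(2) closure_subset[of W] by blast
  moreover obtain \<delta> where "\<delta> > 0" "ball x \<delta> \<subseteq> - closure W"
    using \<open>open (- closure W)\<close> W(3) by (meson ComplI open_contains_ball)
  ultimately show ?thesis
    unfolding finitely_bounded_in_def by blast
qed

(* Connected neighbourhoods need not be open, hence weakly_locally_connected_at. *)
theorem theorem1:
  fixes X :: "complex set"
  assumes "continuum X"
  shows "(\<forall>x\<in>X. modified_fiber X x = modified_pseudo_fiber X x) \<and>
         (\<forall>x\<in>X. modified_fiber X x = {x} \<longrightarrow>
                weakly_locally_connected_at x (top_of_set X))"
proof -
  have X: "compact X" "closed X" "connected X"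
    using assms by (auto simp: continuum_def compact_imp_closed)
  have frontier: "x \<in> frontier X" if "x \<in> X" "x \<notin> interior X" for x
    using that closure_subset by (auto simp: frontier_def)
  have fiber_eq: "modified_fiber X x = modified_pseudo_fiber X x" if "x \<in> X" for x
  proof -
    have "x \<in> modified_pseudo_fiber X x \<and> connected (modified_pseudo_fiber X x)"
    proof (cases "x \<in> interior X")
      case True
      then show ?thesis by (simp add: modified_pseudo_fiber_def)
    next
      case False
      then have "x \<in> frontier X"
        using frontier that by blast
      then show ?thesis
        using connected_not_finitely_separated[of "frontier X" x] X(1) closure_subset
        by (auto simp: modified_pseudo_fiber_frontier[OF X(2)] compact_frontier)
    qed
    then show ?thesis
      by (simp add: modified_fiber_def connected_component_eq_self)
  qed
  moreover have "weakly_locally_connected_at x (top_of_set X)" 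
    if "x \<in> X" "modified_fiber X x = {x}" for x
  proof (rule weakly_locally_connected_at_if_finitely_bounded)
    fix r :: real
    assume "r > 0"
    show "\<exists>G \<delta>. finitely_bounded_in (frontier X) G \<and> G \<subseteq> ball x r \<and> 
               \<delta> > 0 \<and> frontier X \<inter> ball x \<delta> \<subseteq> G"
    proof (cases "x \<in> interior X")
      case True
      then obtain \<delta> where "\<delta> > 0" "ball x \<delta> \<subseteq> interior X"
        by (meson open_contains_ball open_interior)
      then show ?thesis
        by (intro exI[of _ "{}"] exI[of _ \<delta>]) (auto simp: finitely_bounded_in_def frontier_def)
    next
      case False
      then show ?thesis
        using finitely_bounded_neighbourhood_if_trivial_pseudo_fiber[OF X(1) _ _ \<open>r > 0\<close>]
          frontier fiber_eq that by metis
    qed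
  qed (use X that in auto)
  ultimately show ?thesis
    by blast
qed

end
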